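(* The graph log-limit space $\mathcal{L}$ is a convex compact set in $\mathbb{R}^{\mathcal{B}_0}$ (with the product topology).
   Context: Bipartite setting. $\mathcal{B}$ is the set of (isomorphism classes of) finite graphs $H$ whose vertex set is partitioned into two labelled classes $V_1(H),V_2(H)$, with edge set $E(H)\subseteq V_1(H)\times V_2(H)$. Homomorphisms preserve the labels $1,2$; $\mathrm{Hom}(H,G)$ is the set of homomorphisms from $H$ to $G$. $\mathcal{B}_0$ is the set of $G\in\mathcal{B}$ with $E(G)\neq\emptyset$. $P_1$ is the single edge. For $H,G\in\mathcal{B}_0$ put $t(H,G)=|\mathrm{Hom}(H,G)|\,|V_1(G)|^{-|V_1(H)|}|V_2(G)|^{-|V_2(H)|}$, $d(H,G)=-\log t(H,G)$ and $h(H,G)=d(H,G)/d(P_1,G)$; if $E(G)=V_1(G)\times V_2(G)$ (so $d(P_1,G)=0$), set $h(H,G):=|E(H)|$. For $G\in\mathcal{B}_0$ let $\tau(G)=(h(H,G))_{H\in\mathcal{B}_0}\in\mathbb{R}^{\mathcal{B}_0}$. The graph log-limit space $\mathcal{L}$ is the closure of $\{\tau(G):G\in\mathcal{B}_0\}$ in $\mathbb{R}^{\mathcal{B}_0}$. *)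

theory Defs
  imports "HOL-Analysis.Analysis" "HOL-Library.Function_Algebras"
begin

section \<open>Bipartite graphs with labelled classes\<close>

text \<open>
  The two vertex classes are kept as separate sets: the vertex set of the graph is their disjoint
  union, so the same number may name a vertex of class 1 and another vertex of class 2. Every finite
  graph has an isomorphic copy with natural numbers as vertices. Homomorphisms are pairs of maps,
  one for each class; they are extensional so that two of them are equal iff they agree on the
  vertices.
\<close>

datatype bigraph =
  Bigraph (class1: "nat set") (class2: "nat set") (edges: "(nat \<times> nat) set")

definition fin_bigraph :: "bigraph \<Rightarrow> bool" where
  "fin_bigraph G \<longleftrightarrow> finite (class1 G) \<and> finite (class2 G) \<and> edges G \<subseteq> class1 G \<times> class2 G"

definition bigraph_homs :: "bigraph \<Rightarrow> bigraph \<Rightarrow> ((nat \<Rightarrow> nat) \<times> (nat \<Rightarrow> nat)) set" where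
  "bigraph_homs H G =
    {(\<phi>, \<psi>). \<phi> \<in> class1 H \<rightarrow>\<^sub>E class1 G \<and> \<psi> \<in> class2 H \<rightarrow>\<^sub>E class2 G \<and>
              (\<forall>(x, y) \<in> edges H. (\<phi> x, \<psi> y) \<in> edges G)}"

definition bigraph_iso :: "bigraph \<Rightarrow> bigraph \<Rightarrow> bool" where
  "bigraph_iso G H \<longleftrightarrow>
    (\<exists>\<phi> \<psi>. bij_betw \<phi> (class1 G) (class1 H) \<and> bij_betw \<psi> (class2 G) (class2 H) \<and>
      (\<forall>x \<in> class1 G. \<forall>y \<in> class2 G. (x, y) \<in> edges G \<longleftrightarrow> (\<phi> x, \<psi> y) \<in> edges H))"

lemma bigraph_iso_refl: "bigraph_iso G G"
  unfolding bigraph_iso_def by (rule exI[of _ id], rule exI[of _ id]) simp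

lemma bigraph_iso_sym:
  assumes "bigraph_iso G H"
  shows "bigraph_iso H G"
proof -
  obtain f g where f: "bij_betw f (class1 G) (class1 H)" and g: "bij_betw g (class2 G) (class2 H)"
    and e: "\<And>x y. x \<in> class1 G \<Longrightarrow> y \<in> class2 G \<Longrightarrow> (x, y) \<in> edges G \<longleftrightarrow> (f x, g y) \<in> edges H"
    using assms unfolding bigraph_iso_def by blast
  let ?f = "inv_into (class1 G) f" and ?g = "inv_into (class2 G) g"
  have f': "bij_betw ?f (class1 H) (class1 G)" and g': "bij_betw ?g (class2 H) (class2 G)"
    using f g by (simp_all add: bij_betw_inv_into)
  have "(x, y) \<in> edges H \<longleftrightarrow> (?f x, ?g y) \<in> edges G" if "x \<in> class1 H" "y \<in> class2 H" for x y
    using e[of "?f x" "?g y"] that bij_betwE[OF f'] bij_betwE[OF g']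
      bij_betw_inv_into_right[OF f] bij_betw_inv_into_right[OF g] by simp
  then show ?thesis
    unfolding bigraph_iso_def using f' g' by blast
qed

lemma bigraph_iso_trans:
  assumes "bigraph_iso G H" "bigraph_iso H K"
  shows "bigraph_iso G K"
proof -
  obtain f g where f: "bij_betw f (class1 G) (class1 H)" and g: "bij_betw g (class2 G) (class2 H)"
    and e: "\<And>x y. x \<in> class1 G \<Longrightarrow> y \<in> class2 G \<Longrightarrow> (x, y) \<in> edges G \<longleftrightarrow> (f x, g y) \<in> edges H"
    using assms(1) unfolding bigraph_iso_def by blast
  obtain f' g' where f': "bij_betw f' (class1 H) (class1 K)" and g': "bij_betw g' (class2 H) (class2 K)"
    and e': "\<And>x y. x \<in> class1 H \<Longrightarrow> y \<in> class2 H \<Longrightarrow> (x, y) \<in> edges H \<longleftrightarrow> (f' x, g' y) \<in> edges K"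
    using assms(2) unfolding bigraph_iso_def by blast
  have "(x, y) \<in> edges G \<longleftrightarrow> ((f' \<circ> f) x, (g' \<circ> g) y) \<in> edges K"
    if "x \<in> class1 G" "y \<in> class2 G" for x y
    using that e e' bij_betwE[OF f] bij_betwE[OF g] by simp
  then show ?thesis
    unfolding bigraph_iso_def using bij_betw_trans[OF f f'] bij_betw_trans[OF g g'] by blast
qed

lemma finite_bigraph_homs:
  assumes "fin_bigraph H" "fin_bigraph G"
  shows "finite (bigraph_homs H G)"
proof (rule finite_subset)
  show "bigraph_homs H G \<subseteq> (class1 H \<rightarrow>\<^sub>E class1 G) \<times> (class2 H \<rightarrow>\<^sub>E class2 G)"
    unfolding bigraph_homs_def by auto
  show "finite ((class1 H \<rightarrow>\<^sub>E class1 G) \<times> (class2 H \<rightarrow>\<^sub>E class2 G))"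
    using assms unfolding fin_bigraph_def by (intro finite_cartesian_product finite_PiE) auto
qed

lemma card_bigraph_homs_le:
  assumes fin: "fin_bigraph H" "fin_bigraph H'" "fin_bigraph G" "fin_bigraph G'"
    and "bigraph_iso H H'" "bigraph_iso G G'"
  shows "card (bigraph_homs H G) \<le> card (bigraph_homs H' G')"
proof -
  obtain a b where a: "bij_betw a (class1 H') (class1 H)" and b: "bij_betw b (class2 H') (class2 H)"
    and eH: "\<And>x y. x \<in> class1 H' \<Longrightarrow> y \<in> class2 H' \<Longrightarrow> (x, y) \<in> edges H' \<longleftrightarrow> (a x, b y) \<in> edges H"
    using bigraph_iso_sym[OF assms(5)] unfolding bigraph_iso_def by blast
  obtain f g where f: "bij_betw f (class1 G) (class1 G')" and g: "bij_betw g (class2 G) (class2 G')"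
    and eG: "\<And>x y. x \<in> class1 G \<Longrightarrow> y \<in> class2 G \<Longrightarrow> (x, y) \<in> edges G \<longleftrightarrow> (f x, g y) \<in> edges G'"
    using assms(6) unfolding bigraph_iso_def by blast
  define T where "T = (\<lambda>(\<phi>, \<psi>).
    (restrict (\<lambda>x. f (\<phi> (a x))) (class1 H'), restrict (\<lambda>y. g (\<psi> (b y))) (class2 H')))"
  have inj: "u = v"
    if u: "u \<in> A \<rightarrow>\<^sub>E C" and v: "v \<in> A \<rightarrow>\<^sub>E C"
      and p: "bij_betw p A' A" and q: "bij_betw q C C'"
      and eq: "restrict (\<lambda>x. q (u (p x))) A' = restrict (\<lambda>x. q (v (p x))) A'"
    for u v p q :: "nat \<Rightarrow> nat" and A A' C C'
  proof (rule PiE_ext[OF u v])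
    fix i assume i: "i \<in> A"
    then obtain j where j: "j \<in> A'" "i = p j"
      using p unfolding bij_betw_def by auto
    have "q (u i) = q (v i)"
      using fun_cong[OF eq, of j] j by simp
    moreover have "u i \<in> C" "v i \<in> C"
      using u v i by auto
    ultimately show "u i = v i"
      using q unfolding bij_betw_def inj_on_def by blast
  qed
  have "inj_on T (bigraph_homs H G)"
  proof (rule inj_onI, clarify)
    fix h1 h2 k1 k2
    assume h: "(h1, h2) \<in> bigraph_homs H G" and k: "(k1, k2) \<in> bigraph_homs H G"
      and T: "T (h1, h2) = T (k1, k2)"
    have h': "h1 \<in> class1 H \<rightarrow>\<^sub>E class1 G" "h2 \<in> class2 H \<rightarrow>\<^sub>E class2 G"
      using h unfolding bigraph_homs_def by blast+
    have k': "k1 \<in> class1 H \<rightarrow>\<^sub>E class1 G" "k2 \<in> class2 H \<rightarrow>\<^sub>E class2 G"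
      using k unfolding bigraph_homs_def by blast+
    have T': "restrict (\<lambda>x. f (h1 (a x))) (class1 H') = restrict (\<lambda>x. f (k1 (a x))) (class1 H')"
      "restrict (\<lambda>y. g (h2 (b y))) (class2 H') = restrict (\<lambda>y. g (k2 (b y))) (class2 H')"
      using T unfolding T_def by simp_all
    show "h1 = k1 \<and> h2 = k2"
      using inj[OF h'(1) k'(1) a f T'(1)] inj[OF h'(2) k'(2) b g T'(2)] by blast
  qed
  moreover have "T ` bigraph_homs H G \<subseteq> bigraph_homs H' G'"
  proof
    fix z assume "z \<in> T ` bigraph_homs H G"
    then obtain u v where z: "z = T (u, v)" and u: "u \<in> class1 H \<rightarrow>\<^sub>E class1 G"
      and v: "v \<in> class2 H \<rightarrow>\<^sub>E class2 G"
      and uv: "\<And>x y. (x, y) \<in> edges H \<Longrightarrow> (u x, v y) \<in> edges G"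
      unfolding bigraph_homs_def by blast
    have 1: "f (u (a x)) \<in> class1 G'" "u (a x) \<in> class1 G" if "x \<in> class1 H'" for x
      using that u bij_betwE[OF a] bij_betwE[OF f] by (auto simp: PiE_iff)
    have 2: "g (v (b y)) \<in> class2 G'" "v (b y) \<in> class2 G" if "y \<in> class2 H'" for y
      using that v bij_betwE[OF b] bij_betwE[OF g] by (auto simp: PiE_iff)
    have 3: "x \<in> class1 H'" "y \<in> class2 H'" if "(x, y) \<in> edges H'" for x y
      using that fin(2) unfolding fin_bigraph_def by auto
    have 4: "(f (u (a x)), g (v (b y))) \<in> edges G'" if xy: "(x, y) \<in> edges H'" for x y
    proof -
      have "(u (a x), v (b y)) \<in> edges G"
        using xy eH[OF 3[OF xy]] uv by blast
      then show ?thesis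
        using eG[OF 1(2) 2(2)] 3[OF xy] by blast
    qed
    show "z \<in> bigraph_homs H' G'"
      using 1 2 3 4 unfolding z T_def bigraph_homs_def by auto
  qed
  ultimately show ?thesis
    using card_inj_on_le finite_bigraph_homs[OF fin(2,4)] by blast
qed

lemma card_bigraph_homs_iso:
  assumes "fin_bigraph H" "fin_bigraph H'" "fin_bigraph G" "fin_bigraph G'"
    and "bigraph_iso H H'" "bigraph_iso G G'"
  shows "card (bigraph_homs H G) = card (bigraph_homs H' G')"
  using card_bigraph_homs_le[OF assms]
    card_bigraph_homs_le[OF assms(2,1,4,3) assms(5,6)[THEN bigraph_iso_sym]] by simp

lemma edges_iso_image:
  assumes "fin_bigraph G" "fin_bigraph H"
    and f: "bij_betw f (class1 G) (class1 H)" and g: "bij_betw g (class2 G) (class2 H)"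
    and e: "\<And>x y. x \<in> class1 G \<Longrightarrow> y \<in> class2 G \<Longrightarrow> (x, y) \<in> edges G \<longleftrightarrow> (f x, g y) \<in> edges H"
  shows "edges H = map_prod f g ` edges G" "inj_on (map_prod f g) (class1 G \<times> class2 G)"
    "class1 H \<times> class2 H = map_prod f g ` (class1 G \<times> class2 G)"
proof -
  have sub: "edges G \<subseteq> class1 G \<times> class2 G" "edges H \<subseteq> class1 H \<times> class2 H"
    using assms unfolding fin_bigraph_def by auto
  show I: "class1 H \<times> class2 H = map_prod f g ` (class1 G \<times> class2 G)"
    using f g unfolding bij_betw_def by (simp add: map_prod_surj_on)
  show "inj_on (map_prod f g) (class1 G \<times> class2 G)"
    using f g unfolding bij_betw_def by (simp add: map_prod_inj_on)
  show "edges H = map_prod f g ` edges G"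
  proof (intro equalityI subsetI)
    fix p assume p: "p \<in> edges H"
    then obtain x y where "x \<in> class1 G" "y \<in> class2 G" "p = (f x, g y)"
      using sub(2) I by auto
    then show "p \<in> map_prod f g ` edges G"
      using p e by force
  next
    fix p assume "p \<in> map_prod f g ` edges G"
    then show "p \<in> edges H"
      using sub(1) e by auto
  qed
qed

lemma bigraph_iso_invariants:
  assumes "fin_bigraph G" "fin_bigraph H" "bigraph_iso G H"
  shows "card (class1 G) = card (class1 H)" "card (class2 G) = card (class2 H)"
    "card (edges G) = card (edges H)"
    "edges G = class1 G \<times> class2 G \<longleftrightarrow> edges H = class1 H \<times> class2 H"
proof -
  obtain f g where fg: "bij_betw f (class1 G) (class1 H)" "bij_betw g (class2 G) (class2 H)"
    "\<And>x y. x \<in> class1 G \<Longrightarrow> y \<in> class2 G \<Longrightarrow> (x, y) \<in> edges G \<longleftrightarrow> (f x, g y) \<in> edges H"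
    using assms(3) unfolding bigraph_iso_def by blast
  note im = edges_iso_image[OF assms(1,2) fg]
  have sub: "edges G \<subseteq> class1 G \<times> class2 G"
    using assms(1) unfolding fin_bigraph_def by auto
  show "card (class1 G) = card (class1 H)" "card (class2 G) = card (class2 H)"
    using fg bij_betw_same_card by blast+
  show "card (edges G) = card (edges H)"
    using card_image[OF inj_on_subset[OF im(2) sub]] im(1) by metis
  show "edges G = class1 G \<times> class2 G \<longleftrightarrow> edges H = class1 H \<times> class2 H"
    using inj_on_image_eq_iff[OF im(2) sub subset_refl] im(1,3) by metis
qed


section \<open>Isomorphism classes of graphs with at least one edge\<close>

definition bigraph0_eq :: "bigraph \<Rightarrow> bigraph \<Rightarrow> bool" where
  "bigraph0_eq G H \<longleftrightarrow>
    fin_bigraph G \<and> edges G \<noteq> {} \<and> fin_bigraph H \<and> edges H \<noteq> {} \<and> bigraph_iso G H"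

text \<open>
  The partial quotient discards the values outside \<open>fin_bigraph\<close> and those without edges, so
  \<open>bigraph0\<close> is exactly the set of isomorphism classes \<open>\<B>\<^sub>0\<close>.
\<close>

quotient_type bigraph0 = bigraph / partial: bigraph0_eq
proof (rule part_equivpI)
  show "\<exists>x. bigraph0_eq x x"
    by (rule exI[of _ "Bigraph {0} {0} {(0, 0)}"])
      (simp add: bigraph0_eq_def fin_bigraph_def bigraph_iso_refl)
  show "symp bigraph0_eq"
    unfolding symp_def bigraph0_eq_def using bigraph_iso_sym by blast
  show "transp bigraph0_eq"
    unfolding transp_def bigraph0_eq_def using bigraph_iso_trans by blast
qed

lift_definition v1 :: "bigraph0 \<Rightarrow> nat" is "\<lambda>G. card (class1 G)"
  unfolding bigraph0_eq_def using bigraph_iso_invariants(1) by blast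

lift_definition v2 :: "bigraph0 \<Rightarrow> nat" is "\<lambda>G. card (class2 G)"
  unfolding bigraph0_eq_def using bigraph_iso_invariants(2) by blast

lift_definition num_edges :: "bigraph0 \<Rightarrow> nat" is "\<lambda>G. card (edges G)"
  unfolding bigraph0_eq_def using bigraph_iso_invariants(3) by blast

lift_definition complete_bigraph :: "bigraph0 \<Rightarrow> bool" is
  "\<lambda>G. edges G = class1 G \<times> class2 G"
  unfolding bigraph0_eq_def using bigraph_iso_invariants(4) by blast

lift_definition num_homs :: "bigraph0 \<Rightarrow> bigraph0 \<Rightarrow> nat" is
  "\<lambda>H G. card (bigraph_homs H G)"
  unfolding bigraph0_eq_def using card_bigraph_homs_iso by blast

lift_definition P\<^sub>1 :: bigraph0 is "Bigraph {0} {0} {(0, 0)}"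
  by (simp add: bigraph0_eq_def fin_bigraph_def bigraph_iso_refl)


section \<open>Homomorphism densities and the graph log-limit space\<close>

definition hom_density :: "bigraph0 \<Rightarrow> bigraph0 \<Rightarrow> real" where
  "hom_density H G = real (num_homs H G) / (real (v1 G) ^ v1 H * real (v2 G) ^ v2 H)"

definition log_density :: "bigraph0 \<Rightarrow> bigraph0 \<Rightarrow> real" where
  "log_density H G = - ln (hom_density H G)"

definition norm_log_density :: "bigraph0 \<Rightarrow> bigraph0 \<Rightarrow> real" where
  "norm_log_density H G =
    (if complete_bigraph G then real (num_edges H) else log_density H G / log_density P\<^sub>1 G)"

definition tau :: "bigraph0 \<Rightarrow> (bigraph0 \<Rightarrow> real)" where
  "tau G = (\<lambda>H. norm_log_density H G)"

text \<open>
  The topology that the library puts on a function type is the product topology.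
\<close>

definition log_limit_space :: "(bigraph0 \<Rightarrow> real) set" where
  "log_limit_space = closure (range tau)"

instantiation "fun" :: (type, real_vector) real_vector
begin

definition "scaleR_fun c f = (\<lambda>x. c *\<^sub>R f x)"

instance
  by standard (auto simp: scaleR_fun_def fun_eq_iff scaleR_add_right scaleR_add_left)

end

end

theory Submission
  imports Defs
begin

text \<open>
  Compactness: Sidorenko's inequality for complete bipartite graphs gives
  \<open>0 \<le> h(H, G) \<le> v\<^sub>1(H) v\<^sub>2(H)\<close>, so all points \<open>\<tau>(G)\<close> lie in a product of compact intervals.
  Convexity: \<open>d(H, \<cdot>)\<close> is additive under tensor products, so for non-complete \<open>G, G'\<close> the tensor
  product of \<open>k\<close> copies of \<open>G\<close> and \<open>l\<close> copies of \<open>G'\<close> is mapped by \<open>\<tau>\<close> to the convex combination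
  of \<open>\<tau>(G)\<close> and \<open>\<tau>(G')\<close> with weights proportional to \<open>k d(P\<^sub>1, G)\<close> and \<open>l d(P\<^sub>1, G')\<close>; these
  weights are dense. Complete graphs contribute nothing new to the closure, because their value
  of \<open>\<tau>\<close> is the limit of \<open>\<tau>\<close> along \<open>K\<^sub>n\<^sub>,\<^sub>n\<close> minus an edge.
\<close>

section \<open>Representatives and basic bounds\<close>

text \<open>
  As \<open>bigraph0_eq\<close> is a partial equivalence, its reflexive points are exactly the representatives.
\<close>

abbreviation proper_bigraph :: "bigraph \<Rightarrow> bool" where
  "proper_bigraph G \<equiv> bigraph0_eq G G"

lemma proper_bigraph_iff: "proper_bigraph G \<longleftrightarrow> fin_bigraph G \<and> edges G \<noteq> {}"
  by (auto simp: bigraph0_eq_def bigraph_iso_refl)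

lemma proper_bigraphD:
  assumes "proper_bigraph G"
  shows "finite (class1 G)" "finite (class2 G)" "finite (edges G)"
    "edges G \<subseteq> class1 G \<times> class2 G" "edges G \<noteq> {}" "class1 G \<noteq> {}" "class2 G \<noteq> {}"
proof -
  show *: "finite (class1 G)" "finite (class2 G)" "edges G \<subseteq> class1 G \<times> class2 G" "edges G \<noteq> {}"
    using assms by (auto simp: proper_bigraph_iff fin_bigraph_def)
  then show "finite (edges G)" "class1 G \<noteq> {}" "class2 G \<noteq> {}"
    using finite_subset by auto
qed

lemmas abs_bigraph0_simps =
  v1.abs_eq v2.abs_eq num_edges.abs_eq num_homs.abs_eq complete_bigraph.abs_eq

lemma v1_pos: "v1 G > 0" and v2_pos: "v2 G > 0"
  by (induct G rule: bigraph0.abs_induct;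
      simp add: abs_bigraph0_simps card_gt_0_iff proper_bigraphD)+

lemma bigraph_homs_subset:
  "bigraph_homs H G \<subseteq> (class1 H \<rightarrow>\<^sub>E class1 G) \<times> (class2 H \<rightarrow>\<^sub>E class2 G)"
  by (auto simp: bigraph_homs_def)

lemma card_funcset_pair:
  assumes "proper_bigraph H" "proper_bigraph G"
  shows "card ((class1 H \<rightarrow>\<^sub>E class1 G) \<times> (class2 H \<rightarrow>\<^sub>E class2 G))
    = card (class1 G) ^ card (class1 H) * card (class2 G) ^ card (class2 H)"
  using assms by (simp add: card_cartesian_product card_PiE proper_bigraphD)

text \<open>Sending each class of \<open>H\<close> to the corresponding end of one fixed edge of
  \<open>G\<close> is a homomorphism.\<close>

lemma num_homs_pos: "num_homs H G > 0"
proof (induct H rule: bigraph0.abs_induct, induct G rule: bigraph0.abs_induct)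
  fix G H assume G: "proper_bigraph G" and H: "proper_bigraph H"
  obtain u v where uv: "(u, v) \<in> edges G"
    using proper_bigraphD[OF G] by auto
  have "(restrict (\<lambda>_. u) (class1 H), restrict (\<lambda>_. v) (class2 H)) \<in> bigraph_homs H G"
    using uv proper_bigraphD(4)[OF G] proper_bigraphD(4)[OF H] by (auto simp: bigraph_homs_def)
  then show "num_homs (abs_bigraph0 H) (abs_bigraph0 G) > 0"
    using finite_bigraph_homs G H
    by (auto simp: abs_bigraph0_simps card_gt_0_iff proper_bigraph_iff)
qed

lemma num_homs_le: "num_homs H G \<le> v1 G ^ v1 H * v2 G ^ v2 H"
proof (induct H rule: bigraph0.abs_induct, induct G rule: bigraph0.abs_induct)
  fix G H assume G: "proper_bigraph G" and H: "proper_bigraph H"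
  then show "num_homs (abs_bigraph0 H) (abs_bigraph0 G) \<le> v1 (abs_bigraph0 G) ^ v1 (abs_bigraph0 H)
      * v2 (abs_bigraph0 G) ^ v2 (abs_bigraph0 H)"
    using card_mono[OF _ bigraph_homs_subset, of H G]
    by (simp add: card_funcset_pair[OF H G] abs_bigraph0_simps finite_PiE proper_bigraphD)
qed

lemma hom_density_pos: "hom_density H G > 0"
  using num_homs_pos v1_pos v2_pos by (simp add: hom_density_def)

lemma hom_density_le_1: "hom_density H G \<le> 1"
proof -
  have "real (num_homs H G) \<le> real (v1 G ^ v1 H * v2 G ^ v2 H)"
    using num_homs_le of_nat_mono by blast
  then show ?thesis
    using v1_pos[of G] v2_pos[of G] by (simp add: hom_density_def)
qed

lemma log_density_nonneg: "log_density H G \<ge> 0"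
  using hom_density_pos[of H G] hom_density_le_1[of H G] by (simp add: log_density_def)

lemma proper_edge: "proper_bigraph (Bigraph {0} {0} {(0, 0)})"
  by (rule P\<^sub>1.rsp)

lemma v1_P1 [simp]: "v1 P\<^sub>1 = 1" and v2_P1 [simp]: "v2 P\<^sub>1 = 1"
  and num_edges_P1 [simp]: "num_edges P\<^sub>1 = 1"
  unfolding P\<^sub>1_def by (simp_all add: abs_bigraph0_simps proper_edge)

text \<open>A homomorphism from the single edge is determined by the edge onto which it
  maps.\<close>

lemma num_homs_P1: "num_homs P\<^sub>1 G = num_edges G"
proof (induct G rule: bigraph0.abs_induct)
  fix G assume G: "proper_bigraph G"
  let ?P = "Bigraph {0} {0} {(0, 0)}"
  have "bij_betw (\<lambda>(f, g). (f 0, g 0)) (bigraph_homs ?P G) (edges G)"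
    using proper_bigraphD(4)[OF G]
    by (intro bij_betw_byWitness[where f' = "\<lambda>(x, y). (\<lambda>i\<in>{0}. x, \<lambda>i\<in>{0}. y)"])
      (auto simp: bigraph_homs_def fun_eq_iff PiE_iff extensional_def)
  then show "num_homs P\<^sub>1 (abs_bigraph0 G) = num_edges (abs_bigraph0 G)"
    unfolding P\<^sub>1_def using G proper_edge by (simp add: abs_bigraph0_simps bij_betw_same_card)
qed

text \<open>With one vertex in each class of the target, the lower and upper bounds on
  \<open>num_homs\<close> both equal 1. This makes \<open>P\<^sub>1\<close> usable as the empty
  tensor power.\<close>

lemma log_density_to_P1: "log_density H P\<^sub>1 = 0"
  using num_homs_pos[of H P\<^sub>1] num_homs_le[of H P\<^sub>1]
  by (simp add: log_density_def hom_density_def)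

lemma hom_density_P1: "hom_density P\<^sub>1 G = real (num_edges G) / (real (v1 G) * real (v2 G))"
  by (simp add: hom_density_def num_homs_P1)

lemma complete_bigraph_iff: "complete_bigraph G \<longleftrightarrow> num_edges G = v1 G * v2 G"
proof (induct G rule: bigraph0.abs_induct)
  fix G assume G: "proper_bigraph G"
  note D = proper_bigraphD[OF G]
  show "complete_bigraph (abs_bigraph0 G)
    \<longleftrightarrow> num_edges (abs_bigraph0 G) = v1 (abs_bigraph0 G) * v2 (abs_bigraph0 G)"
    using card_subset_eq[of "class1 G \<times> class2 G" "edges G"] G D
    by (auto simp: abs_bigraph0_simps card_cartesian_product)
qed

text \<open>Edge density 1 leaves no pair out. This decides completeness for graphs known only
  through their log densities, such as tensor combinations.\<close>

lemma complete_bigraph_iff_log_density: "complete_bigraph G \<longleftrightarrow> log_density P\<^sub>1 G = 0"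
proof -
  have "log_density P\<^sub>1 G = 0 \<longleftrightarrow> hom_density P\<^sub>1 G = 1"
    using hom_density_pos[of P\<^sub>1 G] by (simp add: log_density_def)
  also have "\<dots> \<longleftrightarrow> num_edges G = v1 G * v2 G"
    using v1_pos[of G] v2_pos[of G] by (auto simp: hom_density_P1 simp flip: of_nat_mult)
  finally show ?thesis
    by (simp add: complete_bigraph_iff)
qed

lemma log_density_P1_pos: "\<not> complete_bigraph G \<Longrightarrow> log_density P\<^sub>1 G > 0"
  using log_density_nonneg[of P\<^sub>1 G] by (simp add: complete_bigraph_iff_log_density)

section \<open>Tensor products\<close>

text \<open>The categorical product, taken class by class. Vertices have to be natural numbers, so
  pairs are stored through \<open>prod_encode\<close>.\<close>

definition bigraph_tensor :: "bigraph \<Rightarrow> bigraph \<Rightarrow> bigraph" where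
  "bigraph_tensor G G' = Bigraph
    (prod_encode ` (class1 G \<times> class1 G')) (prod_encode ` (class2 G \<times> class2 G'))
    {(prod_encode (x, x'), prod_encode (y, y')) | x x' y y'. (x, y) \<in> edges G \<and> (x', y') \<in> edges G'}"

lemma bigraph_tensor_sel [simp]:
  "class1 (bigraph_tensor G G') = prod_encode ` (class1 G \<times> class1 G')"
  "class2 (bigraph_tensor G G') = prod_encode ` (class2 G \<times> class2 G')"
  "(prod_encode (x, x'), prod_encode (y, y')) \<in> edges (bigraph_tensor G G')
    \<longleftrightarrow> (x, y) \<in> edges G \<and> (x', y') \<in> edges G'"
  by (simp_all add: bigraph_tensor_def)

lemma proper_tensor:
  assumes "proper_bigraph G" "proper_bigraph G'"
  shows "proper_bigraph (bigraph_tensor G G')"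
proof -
  obtain x y x' y' where "(x, y) \<in> edges G" "(x', y') \<in> edges G'"
    using assms proper_bigraphD(5) by fastforce
  then have "(prod_encode (x, x'), prod_encode (y, y')) \<in> edges (bigraph_tensor G G')"
    by simp
  then have "edges (bigraph_tensor G G') \<noteq> {}"
    by blast
  moreover have "fin_bigraph (bigraph_tensor G G')"
    using proper_bigraphD[OF assms(1)] proper_bigraphD[OF assms(2)]
    by (auto simp: fin_bigraph_def bigraph_tensor_def)
  ultimately show ?thesis
    by (simp add: proper_bigraph_iff)
qed

text \<open>Universal property of the product: a homomorphism into it is a pair of homomorphisms
  into the factors. The maps are restricted to the classes of \<open>H\<close> so that they remain
  extensional.\<close>

lemma card_homs_tensor:
  assumes "proper_bigraph H"
  shows "card (bigraph_homs H (bigraph_tensor G G'))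
    = card (bigraph_homs H G) * card (bigraph_homs H G')"
proof -
  define pair where "pair = (\<lambda>A (f :: nat \<Rightarrow> nat) f'. \<lambda>x\<in>A. prod_encode (f x, f' x))"
  define left where "left = (\<lambda>A (f :: nat \<Rightarrow> nat). \<lambda>x\<in>A. fst (prod_decode (f x)))"
  define right where "right = (\<lambda>A (f :: nat \<Rightarrow> nat). \<lambda>x\<in>A. snd (prod_decode (f x)))"
  let ?A = "class1 H" and ?B = "class2 H"
  have E: "x \<in> ?A \<and> y \<in> ?B" if "(x, y) \<in> edges H" for x y
    using proper_bigraphD(4)[OF assms] that by auto
  have inv: "left A (pair A f f') = f" "right A (pair A f f') = f'"
    if "f \<in> A \<rightarrow>\<^sub>E C" "f' \<in> A \<rightarrow>\<^sub>E C'" for A C C' f f'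
    using that by (auto simp: pair_def left_def right_def fun_eq_iff PiE_iff extensional_def)
  have inv': "pair A (left A f) (right A f) = f" if "f \<in> A \<rightarrow>\<^sub>E C" for A C f
    using that by (auto simp: pair_def left_def right_def fun_eq_iff PiE_iff extensional_def)
  \<comment> \<open>The selector rule speaks of encoded pairs only; every number is one, since
    \<open>prod_decode\<close> inverts \<open>prod_encode\<close>.\<close>
  have T: "(a, b) \<in> edges (bigraph_tensor G G') \<longleftrightarrow>
      (fst (prod_decode a), fst (prod_decode b)) \<in> edges G \<and>
      (snd (prod_decode a), snd (prod_decode b)) \<in> edges G'" for a b
    using bigraph_tensor_sel(3)[of "fst (prod_decode a)" "snd (prod_decode a)"
      "fst (prod_decode b)" "snd (prod_decode b)" G G'] by simp
  have "bij_betw (\<lambda>((f, g), (f', g')). (pair ?A f f', pair ?B g g'))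
      (bigraph_homs H G \<times> bigraph_homs H G') (bigraph_homs H (bigraph_tensor G G'))"
  proof (rule bij_betw_byWitness[where
        f' = "\<lambda>(f, g). ((left ?A f, left ?B g), (right ?A f, right ?B g))"])
    show "\<forall>a\<in>bigraph_homs H G \<times> bigraph_homs H G'.
       (\<lambda>(f, g). ((left ?A f, left ?B g), (right ?A f, right ?B g)))
        ((\<lambda>((f, g), (f', g')). (pair ?A f f', pair ?B g g')) a) = a"
      by (auto simp: bigraph_homs_def inv)
    show "\<forall>a'\<in>bigraph_homs H (bigraph_tensor G G').
       (\<lambda>((f, g), (f', g')). (pair ?A f f', pair ?B g g'))
        ((\<lambda>(f, g). ((left ?A f, left ?B g), (right ?A f, right ?B g))) a') = a'"
      by (auto simp: bigraph_homs_def inv')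
    show "(\<lambda>((f, g), (f', g')). (pair ?A f f', pair ?B g g')) `
        (bigraph_homs H G \<times> bigraph_homs H G') \<subseteq> bigraph_homs H (bigraph_tensor G G')"
      by (auto simp: bigraph_homs_def pair_def E)
    show "(\<lambda>(f, g). ((left ?A f, left ?B g), (right ?A f, right ?B g))) `
        bigraph_homs H (bigraph_tensor G G') \<subseteq> bigraph_homs H G \<times> bigraph_homs H G'"
      by (auto simp: bigraph_homs_def left_def right_def PiE_iff E T image_iff)
  qed
  then show ?thesis
    by (simp add: bij_betw_same_card card_cartesian_product flip: bij_betw_same_card)
qed

text \<open>Hom counts and class sizes are multiplicative, hence so are densities. The existential
  form hides the representative: only log densities matter from here on.\<close>

lemma log_density_tensor:
  "\<exists>K. \<forall>H. log_density H K = log_density H G + log_density H G'"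
proof (induct G rule: bigraph0.abs_induct, induct G' rule: bigraph0.abs_induct)
  fix G G' assume G: "proper_bigraph G" and G': "proper_bigraph G'"
  define K where "K = abs_bigraph0 (bigraph_tensor G G')"
  let ?G = "abs_bigraph0 G" and ?G' = "abs_bigraph0 G'"
  note T = proper_tensor[OF G G']
  have inj: "inj_on prod_encode S" for S
    using inj_prod_encode inj_on_subset by blast
  have v: "v1 K = v1 ?G * v1 ?G'" "v2 K = v2 ?G * v2 ?G'"
    using G G' T by (simp_all add: K_def abs_bigraph0_simps card_image inj card_cartesian_product)
  have h: "num_homs H K = num_homs H ?G * num_homs H ?G'" for H
    by (induct H rule: bigraph0.abs_induct)
      (use G G' T in \<open>simp add: K_def abs_bigraph0_simps card_homs_tensor\<close>)
  have "hom_density H K = hom_density H ?G * hom_density H ?G'" for H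
    by (simp add: hom_density_def v h power_mult_distrib)
  then have "log_density H K = log_density H ?G + log_density H ?G'" for H
    using hom_density_pos[of H ?G] hom_density_pos[of H ?G'] by (simp add: log_density_def ln_mult)
  then show "\<exists>K. \<forall>H. log_density H K = log_density H ?G + log_density H ?G'"
    by blast
qed

lemma log_density_combination:
  "\<exists>K. \<forall>H. log_density H K = real k * log_density H G + real l * log_density H G'"
proof -
  have pow: "\<exists>K. \<forall>H. log_density H K = real k * log_density H G" for k G
  proof (induct k)
    case 0
    then show ?case
      using log_density_to_P1 by auto
  next
    case (Suc k)
    then obtain K where K: "\<And>H. log_density H K = real k * log_density H G"
      by blast
    show ?case
      using log_density_tensor[of K G] by (simp add: K algebra_simps)
  qed
  obtain K K' where "\<And>H. log_density H K = real k * log_density H G"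
    "\<And>H. log_density H K' = real l * log_density H G'"
    using pow by meson
  then show ?thesis
    using log_density_tensor[of K K'] by simp
qed


section \<open>Compactness\<close>

text \<open>Jensen's inequality for the power function with equal weights.\<close>

lemma power_mean_le:
  fixes f :: "'a \<Rightarrow> real"
  assumes "finite I" "I \<noteq> {}" "\<And>i. i \<in> I \<Longrightarrow> f i \<ge> 0"
  shows "(sum f I / card I) ^ k \<le> (\<Sum>i\<in>I. f i ^ k) / card I"
proof -
  have conv: "convex_on {0..} (\<lambda>x :: real. x ^ k)"
    using convex_power_even[of k] convex_power_odd[of k]
    by (cases "even k") (auto intro: convex_on_subset)
  have "(\<Sum>i\<in>I. (1 / card I) *\<^sub>R f i) ^ k \<le> (\<Sum>i\<in>I. 1 / card I * f i ^ k)"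
    using assms by (intro convex_on_sum[OF _ _ conv]) auto
  then show ?thesis
    by (simp add: sum_divide_distrib)
qed

text \<open>
  Homomorphisms of the complete bipartite graph on the classes of \<open>H\<close> are homomorphisms of \<open>H\<close>;
  they are counted by powers of common neighbourhood sizes, and two power-mean inequalities bound
  that count (Sidorenko's inequality for complete bipartite graphs).
\<close>

lemma hom_density_ge: "hom_density P\<^sub>1 G ^ (v1 H * v2 H) \<le> hom_density H G"
proof (induct H rule: bigraph0.abs_induct, induct G rule: bigraph0.abs_induct)
  fix G H assume G: "proper_bigraph G" and H: "proper_bigraph H"
  note fin = proper_bigraphD[OF G] proper_bigraphD[OF H]
  define A B U V where "A = class1 H" "B = class2 H" "U = class1 G" "V = class2 G"
  note defs = this
  \<comment> \<open>\<open>N v\<close> is the neighbourhood of \<open>v\<close>, and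
    \<open>C f\<close> is the common neighbourhood of the image of \<open>f\<close>.\<close>
  define N where "N = (\<lambda>v. {u \<in> U. (u, v) \<in> edges G})"
  define C where "C = (\<lambda>f. {v \<in> V. \<forall>x\<in>A. (f x, v) \<in> edges G})"
  define I where "I = A \<rightarrow>\<^sub>E U"
  have f: "finite A" "finite B" "finite U" "finite V" "U \<noteq> {}" "V \<noteq> {}" "finite I" "I \<noteq> {}"
    "finite (C g)" for g
    using fin by (auto simp: defs I_def C_def PiE_eq_empty_iff finite_PiE)
  have cI: "card I = card U ^ card A"
    using f by (simp add: I_def card_PiE)
  \<comment> \<open>Once the map on class 1 is \<open>g\<close>, every map of class 2 into
    \<open>C g\<close> completes it to a homomorphism, whatever the edges of \<open>H\<close>
    are.\<close>
  have "(SIGMA g:I. B \<rightarrow>\<^sub>E C g) \<subseteq> bigraph_homs H G"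
    using fin(4,11) by (auto simp: bigraph_homs_def I_def C_def defs PiE_iff)
  then have "card (SIGMA g:I. B \<rightarrow>\<^sub>E C g) \<le> card (bigraph_homs H G)"
    using G H by (intro card_mono finite_bigraph_homs) (auto simp: proper_bigraph_iff)
  also have "card (SIGMA g:I. B \<rightarrow>\<^sub>E C g) = (\<Sum>g\<in>I. card (C g) ^ card B)"
    using f by (simp add: card_SigmaI finite_PiE card_PiE)
  finally have homs: "(\<Sum>g\<in>I. real (card (C g)) ^ card B) \<le> card (bigraph_homs H G)"
    by (simp flip: of_nat_power of_nat_sum)
  \<comment> \<open>Double counting of the pairs of a map \<open>g\<close> and a vertex
    \<open>v\<close> adjacent to all of its image.\<close>
  have "(\<Sum>g\<in>I. card (C g)) = (\<Sum>g\<in>I. sum (\<lambda>_. 1) {v \<in> V. \<forall>x\<in>A. (g x, v) \<in> edges G})"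
    by (simp add: C_def)
  also have "\<dots> = (\<Sum>v\<in>V. card {g \<in> I. \<forall>x\<in>A. (g x, v) \<in> edges G})"
    using f by (subst sum.swap_restrict) auto
  also have "\<dots> = (\<Sum>v\<in>V. card (A \<rightarrow>\<^sub>E N v))"
    by (intro sum.cong arg_cong[where f = card]) (auto simp: I_def N_def intro!: PiE_I dest: PiE_arb PiE_mem)
  also have "\<dots> = (\<Sum>v\<in>V. card (N v) ^ card A)"
    using f by (simp add: card_PiE)
  finally have C: "(\<Sum>g\<in>I. real (card (C g))) = (\<Sum>v\<in>V. real (card (N v)) ^ card A)"
    by (simp flip: of_nat_power of_nat_sum)
  have "(\<Sum>v\<in>V. card (N v)) = card (SIGMA v:V. N v)"
    using f by (simp add: card_SigmaI N_def)
  also have "(SIGMA v:V. N v) = prod.swap ` edges G"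
    using fin(4) by (auto simp: N_def defs)
  also have "card \<dots> = card (edges G)"
    by (rule card_image) simp
  finally have N: "(\<Sum>v\<in>V. real (card (N v))) = card (edges G)"
    by (simp flip: of_nat_sum)
  \<comment> \<open>First power mean: over the vertices \<open>v\<close>, with exponent
    \<open>card A\<close>.\<close>
  have "(card (edges G) / card V) ^ card A \<le> (\<Sum>g\<in>I. real (card (C g))) / card V"
    using power_mean_le[of V "\<lambda>v. real (card (N v))" "card A"] f by (simp add: N C)
  then have "(card (edges G) / card V) ^ card A / card I
      \<le> (\<Sum>g\<in>I. real (card (C g))) / card V / card I"
    by (rule divide_right_mono) simp
  \<comment> \<open>As \<open>card I\<close> is \<open>card U ^ card A\<close>, the left side turns
    into a power of the edge density.\<close>
  then have "(card (edges G) / (card U * card V)) ^ card A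
      \<le> (\<Sum>g\<in>I. real (card (C g))) / card I / card V"
    by (simp add: cI power_divide power_mult_distrib ac_simps)
  then have "((card (edges G) / (card U * card V)) ^ card A) ^ card B
      \<le> ((\<Sum>g\<in>I. real (card (C g))) / card I / card V) ^ card B"
    by (rule power_mono) simp
  also have "\<dots> = ((\<Sum>g\<in>I. real (card (C g))) / card I) ^ card B / real (card V) ^ card B"
    by (rule power_divide)
  \<comment> \<open>Second power mean: over the maps \<open>g\<close>, with exponent
    \<open>card B\<close>.\<close>
  also have "\<dots> \<le> (\<Sum>g\<in>I. real (card (C g)) ^ card B) / card I / real (card V) ^ card B"
    using f by (intro divide_right_mono power_mean_le) auto
  also have "\<dots> \<le> card (bigraph_homs H G) / card I / real (card V) ^ card B"
    using homs by (intro divide_right_mono) auto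
  finally show "hom_density P\<^sub>1 (abs_bigraph0 G) ^ (v1 (abs_bigraph0 H) * v2 (abs_bigraph0 H))
      \<le> hom_density (abs_bigraph0 H) (abs_bigraph0 G)"
    using G H by (simp add: num_homs_P1 abs_bigraph0_simps hom_density_def cI
        flip: defs power_mult)
qed

lemma num_edges_le: "num_edges H \<le> v1 H * v2 H"
proof (induct H rule: bigraph0.abs_induct)
  fix H assume H: "proper_bigraph H"
  then show "num_edges (abs_bigraph0 H) \<le> v1 (abs_bigraph0 H) * v2 (abs_bigraph0 H)"
    using card_mono[OF _ proper_bigraphD(4)[OF H]]
    by (simp add: abs_bigraph0_simps proper_bigraphD card_cartesian_product)
qed

text \<open>Take logarithms in \<open>hom_density_ge\<close> and divide by
  \<open>log_density P\<^sub>1 G\<close>; for complete \<open>G\<close> the value is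
  \<open>num_edges H\<close> and \<open>num_edges_le\<close> applies. The bound is independent of
  \<open>G\<close>, so one box contains all of \<open>range tau\<close>.\<close>

lemma tau_bounds: "0 \<le> tau G H" "tau G H \<le> v1 H * v2 H"
proof -
  have "ln (hom_density P\<^sub>1 G ^ (v1 H * v2 H)) \<le> ln (hom_density H G)"
    using hom_density_ge[of G H] hom_density_pos[of _ G] by (subst ln_le_cancel_iff) auto
  then have "log_density H G \<le> real (v1 H * v2 H) * log_density P\<^sub>1 G"
    using hom_density_pos[of P\<^sub>1 G] by (simp add: log_density_def ln_realpow)
  then show "tau G H \<le> v1 H * v2 H"
    using num_edges_le[of H] log_density_P1_pos[of G]
    by (auto simp: tau_def norm_log_density_def divide_simps simp flip: of_nat_mult)
  show "0 \<le> tau G H"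
    using log_density_nonneg by (simp add: tau_def norm_log_density_def)
qed

text \<open>Tychonoff's theorem, carried over from \<open>product_topology\<close> to the topology
  of the function type.\<close>

lemma compact_Pi_UNIV:
  fixes S :: "'a \<Rightarrow> 'b :: topological_space set"
  assumes "\<And>i. compact (S i)"
  shows "compact (Pi UNIV S)"
proof -
  have "compactin (product_topology (\<lambda>_. euclidean) UNIV) (Pi\<^sub>E UNIV S)"
    using assms by (subst compactin_PiE) simp
  then show ?thesis
    by (simp add: euclidean_product_topology PiE_UNIV_domain)
qed

lemma closed_Pi_UNIV:
  fixes S :: "'a \<Rightarrow> 'b :: topological_space set"
  assumes "\<And>i. closed (S i)"
  shows "closed (Pi UNIV S)"
proof -
  have "closedin (product_topology (\<lambda>_. euclidean) UNIV) (Pi\<^sub>E UNIV S)"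
    using assms by (subst closedin_product_topology) simp
  then show ?thesis
    by (simp add: euclidean_product_topology PiE_UNIV_domain)
qed

lemma tendsto_fun_iff:
  fixes l :: "'a \<Rightarrow> 'b :: topological_space"
  shows "(f \<longlongrightarrow> l) F \<longleftrightarrow> (\<forall>i. ((\<lambda>n. f n i) \<longlongrightarrow> l i) F)"
  using limitin_componentwise[of "\<lambda>_. euclidean" UNIV f l F]
  by (simp add: euclidean_product_topology)

lemma compact_log_limit_space: "compact log_limit_space"
proof -
  let ?P = "Pi UNIV (\<lambda>H. {0..real (v1 H * v2 H)})"
  have P: "compact ?P"
    by (rule compact_Pi_UNIV) simp
  moreover have "range tau \<subseteq> ?P"
    using tau_bounds by (simp add: image_subset_iff Pi_iff del: of_nat_mult)
  ultimately have "closure (range tau) \<subseteq> ?P"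
    by (intro closure_minimal closed_Pi_UNIV) auto
  with P show ?thesis
    unfolding log_limit_space_def by (metis closed_closure compact_Int_closed inf.absorb_iff2)
qed

section \<open>Convex combinations\<close>

text \<open>For incomplete graphs every coordinate of \<open>tau\<close> is a plain quotient of log
  densities, and convergence is coordinatewise. Tensor combinations and
  \<open>complete_minus_edge\<close> are both treated through this criterion.\<close>

lemma limit_of_incomplete_tau:
  assumes "\<And>H. (\<lambda>n. log_density H (K n) / log_density P\<^sub>1 (K n)) \<longlonglongrightarrow> x H"
    and "\<And>n. \<not> complete_bigraph (K n)"
  shows "x \<in> closure (tau ` {G. \<not> complete_bigraph G})"
proof (rule Lim_in_closed_set[of _ "\<lambda>n. tau (K n)" sequentially])
  show "(\<lambda>n. tau (K n)) \<longlonglongrightarrow> x"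
    using assms by (simp add: tendsto_fun_iff tau_def norm_log_density_def)
qed (use assms(2) in \<open>auto intro!: always_eventually subsetD[OF closure_subset]\<close>)

text \<open>Rounding down costs at most 1, hence at most \<open>1 / n\<close> after division. This
  supplies natural multiplicities for real weights.\<close>

lemma tendsto_nat_floor_div:
  fixes c :: real
  assumes "c \<ge> 0"
  shows "(\<lambda>n. real (nat \<lfloor>real n * c\<rfloor>) / real n) \<longlonglongrightarrow> c"
proof (rule tendsto_sandwich[of "\<lambda>n. c - 1 / real n" _ _ "\<lambda>n. c"])
  have "c - 1 / real n \<le> real (nat \<lfloor>real n * c\<rfloor>) / real n"
    "real (nat \<lfloor>real n * c\<rfloor>) / real n \<le> c" if "n > 0" for n
  proof -
    have "real (nat \<lfloor>real n * c\<rfloor>) = real_of_int \<lfloor>real n * c\<rfloor>"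
      using assms by simp
    moreover have "real n * c - 1 \<le> real_of_int \<lfloor>real n * c\<rfloor>" "real_of_int \<lfloor>real n * c\<rfloor> \<le> real n * c"
      by linarith+
    ultimately show "c - 1 / real n \<le> real (nat \<lfloor>real n * c\<rfloor>) / real n"
      "real (nat \<lfloor>real n * c\<rfloor>) / real n \<le> c"
      using that
      by (simp_all add: le_divide_eq divide_le_eq left_diff_distrib mult.commute[of c])
  qed
  then show "\<forall>\<^sub>F n in sequentially. c - 1 / real n \<le> real (nat \<lfloor>real n * c\<rfloor>) / real n"
    "\<forall>\<^sub>F n in sequentially. real (nat \<lfloor>real n * c\<rfloor>) / real n \<le> c"
    by (auto intro: eventually_mono[OF eventually_gt_at_top[of 0]])
  show "(\<lambda>n. c - 1 / real n) \<longlonglongrightarrow> c"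
    using tendsto_diff[OF tendsto_const lim_1_over_n] by simp
qed simp

lemma incomplete_tau_combination:
  assumes G: "\<not> complete_bigraph G" and G': "\<not> complete_bigraph G'"
    and uv: "0 \<le> u" "0 \<le> v" "u + v = 1"
  shows "u *\<^sub>R tau G + v *\<^sub>R tau G' \<in> closure (tau ` {G. \<not> complete_bigraph G})"
proof -
  define d d' where "d = log_density P\<^sub>1 G" "d' = log_density P\<^sub>1 G'"
  have d: "d > 0" "d' > 0"
    using log_density_P1_pos G G' by (auto simp: d_d'_def)
  \<comment> \<open>Multiplicities proportional to \<open>u / d\<close> and \<open>v / d'\<close>:
    the divisions turn \<open>log_density H G\<close> and \<open>log_density H G'\<close> into the
    coordinates of \<open>tau G\<close> and \<open>tau G'\<close>.\<close>
  define k l where "k = (\<lambda>n. nat \<lfloor>real n * (u / d)\<rfloor>)" "l = (\<lambda>n. nat \<lfloor>real n * (v / d')\<rfloor>)"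
  have k: "(\<lambda>n. real (k n) / real n) \<longlonglongrightarrow> u / d" and l: "(\<lambda>n. real (l n) / real n) \<longlonglongrightarrow> v / d'"
    unfolding k_l_def using uv d by (intro tendsto_nat_floor_div; simp)+
  have lim: "(\<lambda>n. (real (k n) * p + real (l n) * q) / real n) \<longlonglongrightarrow> u / d * p + v / d' * q" for p q
    using tendsto_add[OF tendsto_mult_right[OF k, of p] tendsto_mult_right[OF l, of q]]
    by (simp add: add_divide_distrib)
  have "\<forall>n. \<exists>K. \<forall>H. log_density H K
      = real (k n) * log_density H G + real (l n) * log_density H G'"
    using log_density_combination by blast
  from choice[OF this] obtain K where K: "\<And>n H. log_density H (K n)
      = real (k n) * log_density H G + real (l n) * log_density H G'"
    by blast
  \<comment> \<open>For \<open>P\<^sub>1\<close> the divisors cancel and the limit is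
    \<open>u + v\<close>, so the quotient in \<open>lim2\<close> needs no further
    normalisation.\<close>
  have lim1: "(\<lambda>n. log_density P\<^sub>1 (K n) / real n) \<longlonglongrightarrow> 1"
    using lim[of d d'] d uv by (simp add: K flip: d_d'_def)
  have lim2: "(\<lambda>n. log_density H (K n) / log_density P\<^sub>1 (K n))
      \<longlonglongrightarrow> u / d * log_density H G + v / d' * log_density H G'" for H
  proof (rule Lim_transform_eventually)
    show "(\<lambda>n. (log_density H (K n) / real n) / (log_density P\<^sub>1 (K n) / real n))
      \<longlonglongrightarrow> u / d * log_density H G + v / d' * log_density H G'"
      using tendsto_divide[OF lim[of "log_density H G" "log_density H G'"] lim1] by (simp add: K)
    show "\<forall>\<^sub>F n in sequentially. (log_density H (K n) / real n) / (log_density P\<^sub>1 (K n) / real n)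
      = log_density H (K n) / log_density P\<^sub>1 (K n)"
      using eventually_gt_at_top[of 0] by eventually_elim simp
  qed
  \<comment> \<open>Early \<open>K n\<close> can be complete: at \<open>n = 0\<close> both
    multiplicities vanish. Positivity of the limit makes a tail of the sequence incomplete.\<close>
  have "\<forall>\<^sub>F n in sequentially. log_density P\<^sub>1 (K n) / real n > 0"
    using order_tendstoD(1)[OF lim1] by simp
  then obtain n0 where n0: "\<And>n. n \<ge> n0 \<Longrightarrow> log_density P\<^sub>1 (K n) / real n > 0"
    by (auto simp: eventually_sequentially)
  show ?thesis
  proof (rule limit_of_incomplete_tau)
    show "\<not> complete_bigraph (K (n + n0))" for n
      using n0[of "n + n0"] by (auto simp: complete_bigraph_iff_log_density)
    show "(\<lambda>n. log_density H (K (n + n0)) / log_density P\<^sub>1 (K (n + n0)))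
        \<longlonglongrightarrow> (u *\<^sub>R tau G + v *\<^sub>R tau G') H" for H
      using LIMSEQ_ignore_initial_segment[OF lim2[of H], of n0] G G'
      by (simp add: plus_fun_def scaleR_fun_def tau_def norm_log_density_def d_d'_def)
  qed
qed

text \<open>For fixed weights the combination is continuous on pairs, so it maps the closure of
  \<open>S \<times> S\<close> into \<open>closure S\<close>. The hypothesis asks for combinations in
  the closure only, because tensor products merely approximate real weights.\<close>

lemma convex_closure_fun:
  fixes S :: "('a \<Rightarrow> real) set"
  assumes "\<And>x y u v. x \<in> S \<Longrightarrow> y \<in> S \<Longrightarrow> 0 \<le> u \<Longrightarrow> 0 \<le> v \<Longrightarrow> u + v = 1 \<Longrightarrow>
    u *\<^sub>R x + v *\<^sub>R y \<in> closure S"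
  shows "convex (closure S)"
proof (rule convexI)
  fix x y and u v :: real
  assume x: "x \<in> closure S" and y: "y \<in> closure S" and uv: "0 \<le> u" "0 \<le> v" "u + v = 1"
  let ?f = "\<lambda>p :: ('a \<Rightarrow> real) \<times> ('a \<Rightarrow> real). u *\<^sub>R fst p + v *\<^sub>R snd p"
  have coord: "continuous_on UNIV (\<lambda>p :: ('a \<Rightarrow> real) \<times> ('a \<Rightarrow> real). fst p i)"
    "continuous_on UNIV (\<lambda>p :: ('a \<Rightarrow> real) \<times> ('a \<Rightarrow> real). snd p i)" for i
    by (rule continuous_on_product_then_coordinatewise; intro continuous_intros)+
  have "continuous_on UNIV ?f"
    by (rule continuous_on_coordinatewise_then_product)
      (auto simp: plus_fun_def scaleR_fun_def intro!: continuous_intros coord)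
  then have "?f ` closure (S \<times> S) \<subseteq> closure S"
    using assms uv by (intro image_closure_subset) (auto intro: continuous_on_subset)
  then have "?f (x, y) \<in> closure S"
    using x y unfolding closure_Times by blast
  then show "u *\<^sub>R x + v *\<^sub>R y \<in> closure S"
    by simp
qed


section \<open>Approximation of complete graphs\<close>

text \<open>Each \<open>x \<in> S\<close> loses its \<open>n\<close> choices. The product form
  avoids a subtraction in the exponent.\<close>

lemma card_PiE_vanishing:
  assumes "finite A" "S \<subseteq> A" "n > 0"
  shows "card {f \<in> A \<rightarrow>\<^sub>E {..<n}. \<forall>x\<in>S. f x = 0} * n ^ card S = n ^ card A"
proof -
  have "{f \<in> A \<rightarrow>\<^sub>E {..<n}. \<forall>x\<in>S. f x = 0} = Pi\<^sub>E A (\<lambda>x. if x \<in> S then {0} else {..<n})"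
    using assms by (auto simp: PiE_iff extensional_def split: if_splits)
  then have "card {f \<in> A \<rightarrow>\<^sub>E {..<n}. \<forall>x\<in>S. f x = 0} = (\<Prod>x\<in>A. if x \<in> S then 1 else n)"
    using assms(1) by (simp add: card_PiE if_distrib cong: if_cong)
  also have "\<dots> = n ^ card (A - S)"
    using assms by (simp add: prod.If_cases Diff_eq)
  finally show ?thesis
    using assms card_mono[OF assms(1,2)] finite_subset[OF assms(2,1)]
    by (simp add: card_Diff_subset flip: power_add)
qed

text \<open>A new set adds \<open>a\<close> elements minus an overlap of at most
  \<open>card I * b\<close>. The coarse square in place of a binomial coefficient keeps the
  induction simple.\<close>

lemma card_UN_ge_Bonferroni:
  assumes "finite I" "\<And>i. i \<in> I \<Longrightarrow> finite (F i)"
    "\<And>i. i \<in> I \<Longrightarrow> card (F i) = a"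
    "\<And>i j. i \<in> I \<Longrightarrow> j \<in> I \<Longrightarrow> i \<noteq> j \<Longrightarrow> real (card (F i \<inter> F j)) \<le> b"
    "b \<ge> 0"
  shows "real (card I) * real a - (real (card I))\<^sup>2 * b \<le> card (\<Union>i\<in>I. F i)"
  using assms
proof (induct I rule: finite_induct)
  case empty
  then show ?case
    by simp
next
  case (insert i I)
  have IH: "real (card I) * real a - (real (card I))\<^sup>2 * b \<le> card (\<Union>i\<in>I. F i)"
    using insert by simp
  have fin: "finite (\<Union>i\<in>I. F i)" "finite (F i)"
    using insert by auto
  have "card (F i \<inter> (\<Union>j\<in>I. F j)) = card (\<Union>j\<in>I. F i \<inter> F j)"
    by (intro arg_cong[where f = card]) auto
  also have "\<dots> \<le> (\<Sum>j\<in>I. card (F i \<inter> F j))"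
    using insert.hyps(1) by (rule card_UN_le)
  finally have "real (card (F i \<inter> (\<Union>j\<in>I. F j))) \<le> (\<Sum>j\<in>I. real (card (F i \<inter> F j)))"
    by (simp flip: of_nat_sum)
  also have "\<dots> \<le> real (card I) * b"
  proof (rule sum_bounded_above)
    fix j assume "j \<in> I"
    then show "real (card (F i \<inter> F j)) \<le> b"
      using insert.hyps(2) by (intro insert.prems(3)) auto
  qed
  finally have "real (card (F i \<inter> (\<Union>j\<in>I. F j))) \<le> real (card I) * b" .
  moreover have "card (F i) + card (\<Union>j\<in>I. F j) = card (F i \<union> (\<Union>j\<in>I. F j)) + card (F i \<inter> (\<Union>j\<in>I. F j))"
    using card_Un_Int fin by blast
  moreover have "real (card I) * b \<ge> 0"
    using insert.prems by simp
  ultimately show ?case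
    using IH insert.prems insert.hyps by (simp add: algebra_simps power2_eq_square)
qed

text \<open>For \<open>n < 2\<close> no edge remains and the graph represents no element of
  \<open>bigraph0\<close>, hence the assumption \<open>n \<ge> 2\<close> below.\<close>

definition complete_minus_edge :: "nat \<Rightarrow> bigraph" where
  "complete_minus_edge n = Bigraph {..<n} {..<n} ({..<n} \<times> {..<n} - {(0, 0)})"

lemma complete_minus_edge_sel [simp]:
  "class1 (complete_minus_edge n) = {..<n}" "class2 (complete_minus_edge n) = {..<n}"
  "edges (complete_minus_edge n) = {..<n} \<times> {..<n} - {(0, 0)}"
  by (simp_all add: complete_minus_edge_def)

lemma proper_complete_minus_edge:
  assumes "n \<ge> 2"
  shows "proper_bigraph (complete_minus_edge n)"
proof -
  have "(0, 1) \<in> edges (complete_minus_edge n)"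
    using assms by simp
  then show ?thesis
    by (auto simp: proper_bigraph_iff fin_bigraph_def)
qed

lemma incomplete_minus_edge:
  assumes "n \<ge> 2"
  shows "\<not> complete_bigraph (abs_bigraph0 (complete_minus_edge n))"
proof -
  let ?K = "complete_minus_edge n"
  have "(0, 0) \<in> class1 ?K \<times> class2 ?K" "(0, 0) \<notin> edges ?K"
    using assms by simp_all
  then show ?thesis
    using proper_complete_minus_edge[OF assms] by (metis complete_bigraph.abs_eq)
qed

text \<open>A pair of maps fails to be a homomorphism exactly if it sends some edge \<open>e\<close>
  of \<open>H\<close> to \<open>(0, 0)\<close>; these pairs form \<open>X e\<close>. One edge does
  so with probability \<open>1 / n ^ 2\<close>, two distinct edges jointly with at most
  \<open>1 / n ^ 3\<close>. The union bound and the Bonferroni bound give the two estimates.\<close>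

lemma hom_density_complete_minus_edge:
  assumes "n \<ge> 2"
  defines "K \<equiv> abs_bigraph0 (complete_minus_edge n)"
  shows "1 - hom_density H K \<le> num_edges H / real n ^ 2"
    and "num_edges H / real n ^ 2 - (num_edges H)\<^sup>2 / real n ^ 3 \<le> 1 - hom_density H K"
proof (atomize (full), induct H rule: bigraph0.abs_induct)
  fix H assume H: "proper_bigraph H"
  note fin = proper_bigraphD[OF H] and pK = proper_complete_minus_edge[OF assms(1)]
  have n: "n > 0"
    using assms by simp
  define A B E where "A = class1 H" "B = class2 H" "E = edges H"
  note defs = this
  have f: "finite A" "finite B" "finite E" "E \<subseteq> A \<times> B"
    using fin by (auto simp: defs)
  define T where "T = (A \<rightarrow>\<^sub>E {..<n}) \<times> (B \<rightarrow>\<^sub>E {..<n})"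
  define F where "F = (\<lambda>S S'. {f \<in> A \<rightarrow>\<^sub>E {..<n}. \<forall>x\<in>S. f x = 0} \<times> {g \<in> B \<rightarrow>\<^sub>E {..<n}. \<forall>y\<in>S'. g y = 0})"
  define N where "N = n ^ (card A + card B)"
  have T: "card T = N" "finite T"
    using f by (simp_all add: T_def N_def card_cartesian_product card_PiE power_add finite_PiE)
  have F: "card (F S S') * n ^ (card S + card S') = N" if "S \<subseteq> A" "S' \<subseteq> B" for S S'
    unfolding F_def N_def card_cartesian_product power_add
      card_PiE_vanishing[OF f(1) that(1) n, symmetric] card_PiE_vanishing[OF f(2) that(2) n, symmetric]
    by (simp only: ac_simps)
  define X where "X = (\<lambda>(x, y). F {x} {y})"
  have XT: "X e \<subseteq> T" for e
    by (cases e) (auto simp: X_def F_def T_def)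
  then have X_fin: "finite (X e)" for e
    using T(2) finite_subset by blast
  have X: "card (X e) * n ^ 2 = N" if e: "e \<in> E" for e
  proof -
    obtain x y where "e = (x, y)" "x \<in> A" "y \<in> B"
      using e f(4) by blast
    then show ?thesis
      using F[of "{x}" "{y}"] by (simp add: X_def numeral_2_eq_2)
  qed
  have XX: "card (X e \<inter> X e') * n ^ 3 \<le> N" if ee': "e \<in> E" "e' \<in> E" "e \<noteq> e'" for e e'
  proof -
    obtain x y x' y' where e: "e = (x, y)" "x \<in> A" "y \<in> B" "e' = (x', y')" "x' \<in> A" "y' \<in> B"
      using ee'(1,2) f(4) by blast
    have "X e \<inter> X e' = F {x, x'} {y, y'}"
      by (auto simp: X_def F_def e)
    \<comment> \<open>Distinct edges differ in an end, so together they force at least three values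
      to be 0.\<close>
    moreover have "3 \<le> card {x, x'} + card {y, y'}"
      using ee'(3) e by (auto simp: card_insert_if)
    then have "n ^ 3 \<le> n ^ (card {x, x'} + card {y, y'})"
      using n by (intro power_increasing) auto
    then have "card (F {x, x'} {y, y'}) * n ^ 3 \<le> N"
      using F[of "{x, x'}" "{y, y'}"] e by (metis insert_subset empty_subsetI mult_le_mono2)
    ultimately show ?thesis
      by simp
  qed
  have NR: "real N > 0"
    using n by (simp add: N_def)
  have XR: "real (card (X e)) = N / real n ^ 2" if "e \<in> E" for e
    using arg_cong[OF X[OF that], of real] n by (simp add: field_simps)
  have XXR: "real (card (X e \<inter> X e')) \<le> N / real n ^ 3" if "e \<in> E" "e' \<in> E" "e \<noteq> e'" for e e'
  proof -
    have "real (card (X e \<inter> X e') * n ^ 3) \<le> real N"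
      using XX[OF that] of_nat_mono by blast
    then show ?thesis
      using n by (simp add: field_simps)
  qed
  have homs: "bigraph_homs H (complete_minus_edge n) = T - (\<Union>e\<in>E. X e)"
  proof -
    have "(u, v) \<in> bigraph_homs H (complete_minus_edge n) \<longleftrightarrow> (u, v) \<in> T - (\<Union>e\<in>E. X e)" for u v
    proof (cases "(u, v) \<in> T")
      case True
      then have "u x < n" "v y < n" if "(x, y) \<in> E" for x y
        using that f(4) by (auto simp: T_def PiE_iff)
      then show ?thesis
        using True by (auto simp: bigraph_homs_def T_def X_def F_def defs[symmetric])
    qed (auto simp: bigraph_homs_def T_def simp flip: defs)
    then show ?thesis
      by auto
  qed
  have U: "(\<Union>e\<in>E. X e) \<subseteq> T"
    using XT by blast
  have "hom_density (abs_bigraph0 H) K = card (bigraph_homs H (complete_minus_edge n)) / real N"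
    using H pK by (simp add: hom_density_def K_def abs_bigraph0_simps N_def power_add flip: defs)
  also have "card (bigraph_homs H (complete_minus_edge n)) = N - card (\<Union>e\<in>E. X e)"
    using U T by (simp add: homs card_Diff_subset finite_subset)
  also have "real \<dots> = real N - card (\<Union>e\<in>E. X e)"
    using card_mono[OF T(2) U] T(1) by simp
  finally have t: "1 - hom_density (abs_bigraph0 H) K = card (\<Union>e\<in>E. X e) / real N"
    using NR by (simp add: field_simps)
  have m: "num_edges (abs_bigraph0 H) = card E"
    using H by (simp add: abs_bigraph0_simps defs)
  have "real (card (\<Union>e\<in>E. X e)) \<le> (\<Sum>e\<in>E. real (card (X e)))"
    using card_UN_le[OF f(3), of X] by (simp flip: of_nat_sum)
  also have "\<dots> = card E * (N / real n ^ 2)"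
    by (simp add: XR)
  finally have "card (\<Union>e\<in>E. X e) / real N \<le> card E * (N / real n ^ 2) / N"
    by (rule divide_right_mono) simp
  then have upper: "card (\<Union>e\<in>E. X e) / real N \<le> card E / real n ^ 2"
    using NR by simp
  \<comment> \<open>The Bonferroni bound wants the common size as a natural number, so it is read
    off from some edge of \<open>H\<close>.\<close>
  obtain a where a: "\<And>e. e \<in> E \<Longrightarrow> card (X e) = a" "real a = N / real n ^ 2"
  proof -
    obtain e where "e \<in> E"
      using fin(5) by (auto simp: defs)
    then show ?thesis
      using that[of "card (X e)"] X XR n by (metis mult_right_cancel power_not_zero not_gr_zero)
  qed
  have "card E * (N / real n ^ 2) - (real (card E))\<^sup>2 * (N / real n ^ 3) \<le> card (\<Union>e\<in>E. X e)"
    using card_UN_ge_Bonferroni[OF f(3), of X a "N / real n ^ 3"] X_fin XXR a by simp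
  then have "(card E * (N / real n ^ 2) - (real (card E))\<^sup>2 * (N / real n ^ 3)) / N
      \<le> card (\<Union>e\<in>E. X e) / real N"
    by (rule divide_right_mono) simp
  then have "card E / real n ^ 2 - (real (card E))\<^sup>2 / real n ^ 3 \<le> card (\<Union>e\<in>E. X e) / real N"
    using NR by (simp add: diff_divide_distrib)
  then show "1 - hom_density (abs_bigraph0 H) K \<le> num_edges (abs_bigraph0 H) / real n ^ 2 \<and>
    num_edges (abs_bigraph0 H) / real n ^ 2 - (num_edges (abs_bigraph0 H))\<^sup>2 / real n ^ 3
      \<le> 1 - hom_density (abs_bigraph0 H) K"
    using upper by (simp add: t m)
qed

text \<open>The estimates give the limit of \<open>n ^ 2 * (1 - t n)\<close> for the density
  \<open>t n\<close>; as \<open>t n\<close> tends to 1, \<open>- ln (t n)\<close> may replace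
  \<open>1 - t n\<close>.\<close>

lemma log_density_complete_minus_edge:
  "(\<lambda>n. real n ^ 2 * log_density H (abs_bigraph0 (complete_minus_edge n))) \<longlonglongrightarrow> num_edges H"
proof -
  define t where "t = (\<lambda>n. hom_density H (abs_bigraph0 (complete_minus_edge n)))"
  define m where "m = real (num_edges H)"
  have t: "0 < t n" "t n \<le> 1" for n
    by (simp_all add: t_def hom_density_pos hom_density_le_1)
  have bounds: "m / real n ^ 2 - m\<^sup>2 / real n ^ 3 \<le> 1 - t n" "1 - t n \<le> m / real n ^ 2" if "n \<ge> 2" for n
    using hom_density_complete_minus_edge[OF that, of H] by (simp_all add: t_def m_def)
  have q: "(\<lambda>n. real n ^ 2 * (1 - t n)) \<longlonglongrightarrow> m"
  proof (rule tendsto_sandwich[of "\<lambda>n. m - m\<^sup>2 / real n" _ _ "\<lambda>n. m"])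
    have "m - m\<^sup>2 / real n \<le> real n ^ 2 * (1 - t n)" "real n ^ 2 * (1 - t n) \<le> m" if "n \<ge> 2" for n
      using mult_left_mono[OF bounds(1)[OF that], of "real n ^ 2"]
        mult_left_mono[OF bounds(2)[OF that], of "real n ^ 2"] that
      by (simp_all add: right_diff_distrib power3_eq_cube power2_eq_square)
    then show "\<forall>\<^sub>F n in sequentially. m - m\<^sup>2 / real n \<le> real n ^ 2 * (1 - t n)"
      "\<forall>\<^sub>F n in sequentially. real n ^ 2 * (1 - t n) \<le> m"
      by (auto intro: eventually_mono[OF eventually_ge_at_top[of 2]])
    show "(\<lambda>n. m - m\<^sup>2 / real n) \<longlonglongrightarrow> m"
      using tendsto_diff[OF tendsto_const tendsto_divide_0[OF tendsto_const filterlim_real_at_infinity_sequentially]]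
      by simp
  qed simp
  have "(\<lambda>n. real n ^ 2 * (1 - t n) * (1 / real n) * (1 / real n)) \<longlonglongrightarrow> m * 0 * 0"
    by (intro tendsto_mult q lim_1_over_n)
  moreover have "\<forall>\<^sub>F n in sequentially. real n ^ 2 * (1 - t n) * (1 / real n) * (1 / real n) = 1 - t n"
    using eventually_gt_at_top[of 0] by eventually_elim (simp add: power2_eq_square)
  ultimately have "(\<lambda>n. 1 - t n) \<longlonglongrightarrow> 0"
    using Lim_transform_eventually by fastforce
  then have t1: "t \<longlonglongrightarrow> 1"
    using tendsto_diff[OF tendsto_const, of "\<lambda>n. 1 - t n" 0 sequentially 1] by simp
  have "(\<lambda>n. real n ^ 2 * - ln (t n)) \<longlonglongrightarrow> m"
  proof (rule tendsto_sandwich[OF _ _ q])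
    \<comment> \<open>Both bounds are \<open>ln s \<le> s - 1\<close>, at \<open>s = t n\<close> and
      at \<open>s = 1 / t n\<close>.\<close>
    have "1 - t n \<le> - ln (t n)" "- ln (t n) \<le> (1 - t n) / t n" for n
      using ln_le_minus_one[OF t(1)[of n]] ln_le_minus_one[of "1 / t n"] t[of n]
      by (simp_all add: ln_div diff_divide_distrib)
    then show "\<forall>\<^sub>F n in sequentially. real n ^ 2 * (1 - t n) \<le> real n ^ 2 * - ln (t n)"
      "\<forall>\<^sub>F n in sequentially. real n ^ 2 * - ln (t n) \<le> real n ^ 2 * (1 - t n) / t n"
      unfolding times_divide_eq_right[symmetric]
      by (intro always_eventually allI mult_left_mono; simp)+
    show "(\<lambda>n. real n ^ 2 * (1 - t n) / t n) \<longlonglongrightarrow> m"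
      using tendsto_divide[OF q t1] by simp
  qed
  then show ?thesis
    by (simp add: log_density_def t_def m_def)
qed

text \<open>
  For complete \<open>G\<close> the convention \<open>h(H, G) = |E(H)|\<close> agrees with the limit of \<open>h(H, K)\<close> along
  \<open>K = complete_minus_edge n\<close>, as \<open>n\<^sup>2 d(H, K)\<close> tends to \<open>|E(H)|\<close>.
\<close>

lemma range_tau_subset: "range tau \<subseteq> closure (tau ` {G. \<not> complete_bigraph G})"
proof (rule image_subsetI)
  fix G
  show "tau G \<in> closure (tau ` {G. \<not> complete_bigraph G})"
  proof (cases "complete_bigraph G")
    case True
    define K where "K = (\<lambda>n. abs_bigraph0 (complete_minus_edge n))"
    show ?thesis
    proof (rule limit_of_incomplete_tau)
      \<comment> \<open>The shift by 2 skips the edgeless graphs.\<close>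
      show "\<not> complete_bigraph (K (n + 2))" for n
        unfolding K_def by (rule incomplete_minus_edge) simp
      show "(\<lambda>n. log_density H (K (n + 2)) / log_density P\<^sub>1 (K (n + 2))) \<longlonglongrightarrow> tau G H" for H
      proof (rule LIMSEQ_ignore_initial_segment, rule Lim_transform_eventually)
        show "(\<lambda>n. (real n ^ 2 * log_density H (K n)) / (real n ^ 2 * log_density P\<^sub>1 (K n)))
            \<longlonglongrightarrow> tau G H"
          using tendsto_divide[OF log_density_complete_minus_edge[of H]
              log_density_complete_minus_edge[of P\<^sub>1]] True
          by (simp add: K_def tau_def norm_log_density_def)
        show "\<forall>\<^sub>F n in sequentially.
            (real n ^ 2 * log_density H (K n)) / (real n ^ 2 * log_density P\<^sub>1 (K n))
              = log_density H (K n) / log_density P\<^sub>1 (K n)"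
          using eventually_gt_at_top[of 0] by eventually_elim simp
      qed
    qed
  qed (auto intro!: subsetD[OF closure_subset])
qed

theorem lemma4p3:
  shows "convex log_limit_space \<and> compact log_limit_space"
proof
  let ?S = "tau ` {G. \<not> complete_bigraph G}"
  have "log_limit_space = closure ?S"
    unfolding log_limit_space_def
    by (intro equalityI closure_minimal range_tau_subset closure_mono) auto
  moreover have "convex (closure ?S)"
    by (rule convex_closure_fun) (use incomplete_tau_combination in blast)
  ultimately show "convex log_limit_space"
    by simp
qed (rule compact_log_limit_space)

end
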